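(* Let $n\ge 2$ and $m^*<m<1$, where $m^*:=(n-3)/(n-1)$ if $n\ge 3$ and $m^*:=0$ if $n=2$. Let $a\in\mathbb{R}^n\setminus\{0\}$ and let $$U(x,t)=C\big(|a|\,|x-ta|+a\cdot(x-ta)\big)^{-\frac{1}{1-m}},$$ where $C>0$ is the constant, depending only on $n$ and $m$, for which $U$ solves $u_t=\Delta u^m$ at all points $(x,t)\in\mathbb{R}^n\times\mathbb{R}$ with $|a|\,|x-ta|+a\cdot(x-ta)>0$. Then $U\notin L^p_{loc}(\mathbb{R}^n\times\mathbb{R})$ for any $p\ge 1$.
   Context: $U$ is a singular traveling wave solution of the fast diffusion equation with velocity vector $a$; it is defined almost everywhere on $\mathbb{R}^n\times\mathbb{R}$, namely where $|a|\,|x-ta|+a\cdot(x-ta)>0$. *)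

theory Defs
  imports "HOL-Analysis.Analysis"
begin

definition m_star :: "nat \<Rightarrow> real" where
  "m_star n = (if n \<ge> 3 then (real n - 3) / (real n - 1) else 0)"

definition tw_domain :: "real ^ 'n \<Rightarrow> ((real ^ 'n) \<times> real) set" where
  "tw_domain a = {(x, t). norm a * norm (x - t *\<^sub>R a) + a \<bullet> (x - t *\<^sub>R a) > 0}"

(* Off tw_domain a, which is open with null complement in dimension at least 2,
   the convention 0 powr _ = 0 gives the value 0. *)
definition tw_sol :: "real \<Rightarrow> real \<Rightarrow> real ^ 'n \<Rightarrow> (real ^ 'n) \<times> real \<Rightarrow> real" where
  "tw_sol C m a = (\<lambda>(x, t).
     C * (norm a * norm (x - t *\<^sub>R a) + a \<bullet> (x - t *\<^sub>R a)) powr (- (1 / (1 - m))))"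

definition partial_deriv :: "'a::euclidean_space \<Rightarrow> ('a \<Rightarrow> real) \<Rightarrow> 'a \<Rightarrow> real" where
  "partial_deriv b f x = frechet_derivative f (at x) b"

definition twice_differentiable_at :: "('a::euclidean_space \<Rightarrow> real) \<Rightarrow> 'a \<Rightarrow> bool" where
  "twice_differentiable_at f x \<longleftrightarrow>
     (\<forall>\<^sub>F y in nhds x. f differentiable (at y)) \<and>
     (\<forall>b\<in>Basis. partial_deriv b f differentiable (at x))"

definition laplacian :: "('a::euclidean_space \<Rightarrow> real) \<Rightarrow> 'a \<Rightarrow> real" where
  "laplacian f x = (\<Sum>b\<in>Basis. partial_deriv b (partial_deriv b f) x)"

(* Classical solution of u_t = Laplace_x (u^m) at the point (x, t).  The derivatives
   are required to exist, since deriv and frechet_derivative are total functions. *)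
definition solves_fde_at ::
    "real \<Rightarrow> ('a::euclidean_space \<times> real \<Rightarrow> real) \<Rightarrow> 'a \<times> real \<Rightarrow> bool" where
  "solves_fde_at m u = (\<lambda>(x, t).
     (\<lambda>s. u (x, s)) differentiable (at t) \<and>
     twice_differentiable_at (\<lambda>y. u (y, t) powr m) x \<and>
     deriv (\<lambda>s. u (x, s)) t = laplacian (\<lambda>y. u (y, t) powr m) x)"

(* Locally p-integrable functions on the whole space, for real p. *)
definition Lp_loc :: "real \<Rightarrow> ('a::euclidean_space \<Rightarrow> real) set" where
  "Lp_loc p = {f. f \<in> borel_measurable lebesgue \<and>
     (\<forall>K. compact K \<longrightarrow> set_integrable lebesgue K (\<lambda>z. \<bar>f z\<bar> powr p))}"

end

theory Submission
  imports Defs "HOL-Real_Asymp.Real_Asymp"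
begin

text \<open>
  The profile \<open>w(z) = |a| |z| + a \<bullet> z\<close>, with \<open>z = x - t a\<close>, vanishes exactly when \<open>z\<close> lies
  on the ray opposite to \<open>a\<close>. In space-time this is the half-plane
  \<open>{(t a - s a/|a|, t). s \<ge> 0}\<close>, whose codimension is \<open>n - 1\<close>. Near it and away from \<open>z = 0\<close>
  the profile vanishes to second order: \<open>w = O(\<rho>\<^sup>2)\<close> at distance \<open>\<rho>\<close>
  (\<open>norm_add_inner_near_ray\<close>). With \<open>q = p/(1-m)\<close> this gives \<open>|U|\<close> to the power \<open>p\<close>
  the size at least \<open>c \<rho>\<close> to the power \<open>-2q\<close> on a \<open>\<rho>\<close>-neighbourhood of volume
  comparable to \<open>\<rho>\<close> to the power \<open>n-1\<close>. The bound \<open>m > m*\<close> says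
  \<open>2/(1-m) > n - 1\<close> for \<open>n \<ge> 3\<close> and implies it for \<open>n = 2\<close>, so \<open>2q > n - 1\<close>
  (\<open>critical_exponent\<close>), and Chebyshev's inequality makes the integral over a fixed compact set
  exceed every constant as \<open>\<rho> \<rightarrow> 0\<close>.

  The volume of the neighbourhood is bounded below by packing: a square grid of \<open>N\<^sup>2\<close> points
  on the half-plane carries disjoint balls of radius \<open>1/(2N)\<close> in dimension \<open>n + 1\<close>
  (\<open>packed_balls_near_singular_set\<close>). Their total volume is of order
  \<open>N\<close> to the power \<open>1-n\<close>, as needed, without rotating \<open>a\<close> to a coordinate axis or
  slicing the integral.
\<close>

section \<open>Lower bounds for integrals by packing balls\<close>

text \<open>Chebyshev's inequality on a union of balls which the separation makes disjoint. The null
  set \<open>Z\<close> is there for functions that carry a conventional small value on their singular set.\<close>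

lemma integral_ge_of_separated_balls:
  fixes c :: "'i \<Rightarrow> 'a::euclidean_space" and f :: "'a \<Rightarrow> real"
  assumes "finite I" "r \<ge> 0"
    and sep: "\<And>i j. i \<in> I \<Longrightarrow> j \<in> I \<Longrightarrow> i \<noteq> j \<Longrightarrow> 2 * r \<le> dist (c i) (c j)"
    and sub: "\<And>i. i \<in> I \<Longrightarrow> ball (c i) r \<subseteq> K"
    and int: "set_integrable lebesgue K f"
    and nonneg: "\<And>x. x \<in> K \<Longrightarrow> 0 \<le> f x"
    and Z: "negligible Z"
    and M: "\<And>i x. i \<in> I \<Longrightarrow> x \<in> ball (c i) r \<Longrightarrow> x \<notin> Z \<Longrightarrow> M \<le> f x"
  shows "M * (real (card I) * (unit_ball_vol (real DIM('a)) * r ^ DIM('a)))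
           \<le> (LINT x:K|lebesgue. f x)"
proof -
  let ?V = "\<Union>i\<in>I. ball (c i) r"
  have disj: "disjoint_family_on (\<lambda>i. ball (c i) r) I"
    unfolding disjoint_family_on_def
  proof (intro ballI impI)
    fix i j assume ij: "i \<in> I" "j \<in> I" "i \<noteq> j"
    have False if "x \<in> ball (c i) r" "x \<in> ball (c j) r" for x
      using that sep[OF ij] dist_triangle2[of "c i" "c j" x]
      by (simp add: dist_commute)
    then show "ball (c i) r \<inter> ball (c j) r = {}" by blast
  qed
  have Vm: "?V \<in> lmeasurable"
    using assms(1) by (intro fmeasurable.finite_UN) auto
  have Zs: "Z \<in> null_sets lebesgue" using Z negligible_iff_null_sets by blast
  have Bm: "?V - Z \<in> lmeasurable"
    using Vm Zs by (auto intro!: fmeasurable_Diff)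
  have "measure lebesgue (?V - Z) = measure lebesgue ?V"
    using Vm Zs by (intro measure_Diff_null_set) auto
  also have "\<dots> = (\<Sum>i\<in>I. measure lebesgue (ball (c i) r))"
    using assms(1) disj
    by (intro measure_finite_Union) (use emeasure_lborel_ball_finite in \<open>auto simp: less_top\<close>)
  also have "\<dots> = real (card I) * (unit_ball_vol (real DIM('a)) * r ^ DIM('a))"
    using assms(2) by (simp add: content_ball)
  finally have vol: "measure lebesgue (?V - Z)
      = real (card I) * (unit_ball_vol (real DIM('a)) * r ^ DIM('a))" .
  have "M * measure lebesgue (?V - Z) = (LINT x|lebesgue. M * indicator (?V - Z) x)"
    using Bm by simp
  also have "\<dots> \<le> (LINT x|lebesgue. indicator K x *\<^sub>R f x)"
  proof (rule integral_mono)
    show "integrable lebesgue (\<lambda>x. M * indicator (?V - Z) x)"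
      using Bm by (intro integrable_mult_right integrable_real_indicator)
        (auto simp: fmeasurable_def)
    show "integrable lebesgue (\<lambda>x. indicator K x *\<^sub>R f x)"
      using int unfolding set_integrable_def .
    fix x
    show "M * indicator (?V - Z) x \<le> indicator K x *\<^sub>R f x"
    proof (cases "x \<in> ?V - Z")
      case True
      then obtain i where i: "i \<in> I" "x \<in> ball (c i) r" "x \<notin> Z" by blast
      then have "x \<in> K" using sub by blast
      then show ?thesis using True M[OF i] by simp
    next
      case False
      then show ?thesis using nonneg[of x] by (auto simp: indicator_def)
    qed
  qed
  finally show ?thesis unfolding vol set_lebesgue_integral_def .
qed

section \<open>The singular set of the wave\<close>

text \<open>With \<open>e = sgn a\<close>, the factorisation
  \<open>(|z| + e \<bullet> z) (|z| - e \<bullet> z) = |z|\<^sup>2 - (e \<bullet> z)\<^sup>2\<close> has as right-hand side the squared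
  distance from \<open>z\<close> to the line of \<open>a\<close>, which only the perturbation \<open>h\<close> feels; the second
  factor on the left stays above \<open>1/2\<close>. Hence the vanishing is quadratic in \<open>h\<close>.\<close>

lemma norm_add_inner_near_ray:
  fixes a h :: "'a::real_inner"
  assumes s: "1 \<le> s" and h: "norm h \<le> \<rho>" "\<rho> \<le> 1/2"
  defines "z \<equiv> h - s *\<^sub>R sgn a"
  shows "norm a * norm z + a \<bullet> z \<le> 2 * norm a * \<rho>\<^sup>2"
proof (cases "a = 0")
  case True
  then show ?thesis by simp
next
  case False
  define e where "e = sgn a"
  have a: "a = norm a *\<^sub>R e" and e: "norm e = 1" "e \<bullet> e = 1"
    using False by (auto simp: e_def sgn_div_norm norm_sgn dot_square_norm)
  have "\<bar>e \<bullet> h\<bar> \<le> \<rho>"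
    using Cauchy_Schwarz_ineq2[of e h] e h by simp
  then have ez: "e \<bullet> z \<le> - 1/2"
    using s h e by (simp add: z_def e_def[symmetric] inner_diff_right)
  have "norm h ^ 2 - (e \<bullet> h)\<^sup>2 = norm z ^ 2 - (e \<bullet> z)\<^sup>2"
    using e(2) unfolding z_def e_def[symmetric] power2_norm_eq_inner
    by (simp add: inner_diff_right inner_diff_left inner_commute power2_eq_square algebra_simps)
  also have "\<dots> = (norm z + e \<bullet> z) * (norm z - e \<bullet> z)"
    by (simp add: power2_eq_square algebra_simps)
  also have "\<dots> \<ge> (norm z + e \<bullet> z) * (1/2)"
  proof (rule mult_left_mono)
    show "1 / 2 \<le> norm z - e \<bullet> z" using ez norm_ge_zero[of z] by linarith
    show "0 \<le> norm z + e \<bullet> z" using Cauchy_Schwarz_ineq2[of e z] e by simp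
  qed
  finally have "(norm z + e \<bullet> z) * (1/2) \<le> norm h ^ 2 - (e \<bullet> h)\<^sup>2" .
  moreover have "norm h ^ 2 \<le> \<rho> ^ 2" using h by (intro power_mono) auto
  ultimately have "norm z + e \<bullet> z \<le> 2 * \<rho>\<^sup>2"
    using zero_le_power2[of "e \<bullet> h"] by argo
  then have "norm a * (norm z + e \<bullet> z) \<le> norm a * (2 * \<rho>\<^sup>2)"
    by (intro mult_left_mono) auto
  moreover have "a \<bullet> z = norm a * (e \<bullet> z)" by (subst a) simp
  ultimately show ?thesis by (simp add: algebra_simps)
qed

text \<open>The degenerate points of Cauchy-Schwarz form a half-plane, inside a two-dimensional
  subspace of a space of dimension at least three.\<close>

lemma negligible_Compl_tw_domain:
  fixes a :: "real ^ 'n"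
  assumes "CARD('n) \<ge> 2" "a \<noteq> 0"
  shows "negligible (- tw_domain a)"
proof -
  let ?B = "{(a, 0), (a, 1)} :: ((real ^ 'n) \<times> real) set"
  have "dim (span ?B) \<le> card ?B"
    unfolding dim_span by (rule dim_le_card') simp
  also have "\<dots> < DIM((real ^ 'n) \<times> real)"
    using assms(1) by (simp add: DIM_prod)
  finally have "negligible (span ?B)" by (intro negligible_lowdim)
  moreover have "- tw_domain a \<subseteq> span ?B"
  proof clarify
    fix x t assume "(x, t) \<notin> tw_domain a"
    then have "norm a * norm (x - t *\<^sub>R a) + a \<bullet> (x - t *\<^sub>R a) \<le> 0"
      by (simp add: tw_domain_def)
    then have "a \<bullet> - (x - t *\<^sub>R a) = norm a * norm (- (x - t *\<^sub>R a))"
      using norm_cauchy_schwarz[of a "- (x - t *\<^sub>R a)"]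
      by (simp only: norm_minus_cancel inner_minus_right)
    then have "norm a *\<^sub>R - (x - t *\<^sub>R a) = norm (- (x - t *\<^sub>R a)) *\<^sub>R a"
      using norm_cauchy_schwarz_eq by metis
    then have "inverse (norm a) *\<^sub>R norm a *\<^sub>R - (x - t *\<^sub>R a)
        = inverse (norm a) *\<^sub>R norm (- (x - t *\<^sub>R a)) *\<^sub>R a" by simp
    then have "- (x - t *\<^sub>R a) = (inverse (norm a) * norm (- (x - t *\<^sub>R a))) *\<^sub>R a"
      using assms(2) by simp
    then obtain l where l: "- (x - t *\<^sub>R a) = l *\<^sub>R a" by blast
    then have "x = t *\<^sub>R a - l *\<^sub>R a" by (simp add: algebra_simps)
    then have "(x, t) = t *\<^sub>R (a, 1) - l *\<^sub>R (a, 0)" by simp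
    also have "\<dots> \<in> span ?B" by (intro span_diff span_scale span_base) auto
    finally show "(x, t) \<in> span ?B" .
  qed
  ultimately show ?thesis by (rule negligible_subset)
qed

lemma critical_exponent:
  assumes "n \<ge> 2" "m_star n < m" "m < 1" "p \<ge> 1"
  shows "real n - 1 < 2 * (p / (1 - m))"
proof -
  have "(real n - 1) * (1 - m) < 2"
  proof (cases "n \<ge> 3")
    case True
    then have "real n - 3 < m * (real n - 1)"
      using assms(2) by (simp add: m_star_def pos_divide_less_eq)
    then show ?thesis by (simp add: algebra_simps)
  next
    case False
    then have "n = 2" using assms(1) by simp
    then show ?thesis using assms(2) by (simp add: m_star_def)
  qed
  then have "real n - 1 < 2 * (1 / (1 - m))"
    using assms(3) by (simp add: pos_less_divide_eq)
  also have "\<dots> \<le> 2 * (p / (1 - m))"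
    using assms(3,4) by (simp add: divide_right_mono)
  finally show ?thesis .
qed

text \<open>The point must lie in the domain: at a zero of the profile the left-hand side may be
  positive, while the solution is given the value \<open>0\<close> there.\<close>

lemma tw_sol_powr_ge:
  assumes "(x, t) \<in> tw_domain a" "C > 0" "m < 1" "p \<ge> 1"
    and "norm a * norm (x - t *\<^sub>R a) + a \<bullet> (x - t *\<^sub>R a) \<le> B"
  shows "C powr p * B powr (- (p / (1 - m))) \<le> \<bar>tw_sol C m a (x, t)\<bar> powr p"
proof -
  let ?w = "norm a * norm (x - t *\<^sub>R a) + a \<bullet> (x - t *\<^sub>R a)"
  have w: "?w > 0" using assms(1) by (simp add: tw_domain_def)
  have "\<bar>tw_sol C m a (x, t)\<bar> powr p = C powr p * ?w powr (- (p / (1 - m)))"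
    using assms(2) by (simp add: tw_sol_def abs_mult powr_mult powr_powr)
  moreover have "B powr (- (p / (1 - m))) \<le> ?w powr (- (p / (1 - m)))"
    using assms(3-5) w by (intro powr_mono2') auto
  ultimately show ?thesis by (simp add: mult_left_mono)
qed

text \<open>The grid starts at distance \<open>1\<close> behind the apex \<open>z = 0\<close>, where the quadratic bound on
  the profile degenerates. Grid points are separated through their time coordinates, or, at
  equal times, through their distances along the ray. Passing from \<open>(x, t)\<close> to \<open>x - t a\<close>
  stretches distances by at most \<open>1 + |a|\<close>, which explains the radius \<open>r (1 + |a|)\<close> in the last claim and
  the lower bound on \<open>N\<close>: it makes \<open>r (1 + |a|) \<le> 1/2\<close>.\<close>

lemma packed_balls_near_singular_set:
  fixes a :: "real ^ 'n" and N :: nat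
  assumes "a \<noteq> 0" and N: "1 + norm a \<le> real N"
  defines "r \<equiv> 1 / (2 * real N)"
    and "c \<equiv> \<lambda>(j::nat, k::nat). ((real k / N) *\<^sub>R a - (1 + real j / N) *\<^sub>R sgn a, real k / N)"
    and "I \<equiv> {..<N} \<times> {..<N}"
  shows "\<And>i i'. i \<in> I \<Longrightarrow> i' \<in> I \<Longrightarrow> i \<noteq> i' \<Longrightarrow> 2 * r \<le> dist (c i) (c i')"
    and "\<And>i. i \<in> I \<Longrightarrow> ball (c i) r \<subseteq> cball 0 (4 + norm a)"
    and "\<And>i x t. i \<in> I \<Longrightarrow> (x, t) \<in> ball (c i) r \<Longrightarrow>
       norm a * norm (x - t *\<^sub>R a) + a \<bullet> (x - t *\<^sub>R a) \<le> 2 * norm a * (r * (1 + norm a))\<^sup>2"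
proof -
  have N1: "real N \<ge> 1" using N norm_ge_zero[of a] by linarith
  have e: "norm (sgn a) = 1" using assms(1) by (simp add: norm_sgn)
  have r: "2 * r = 1 / N" "r \<le> 1/2" using N1 by (auto simp: r_def divide_simps)
  have gap: "1 / N \<le> \<bar>real j / N - real k / N\<bar>" if "j \<noteq> k" for j k :: nat
  proof -
    have "1 \<le> \<bar>real j - real k\<bar>" using that by linarith
    then have "1 / N \<le> \<bar>real j - real k\<bar> / \<bar>real N\<bar>" by (simp add: divide_right_mono)
    then show ?thesis by (simp add: diff_divide_distrib[symmetric])
  qed
  show "2 * r \<le> dist (c i) (c i')" if "i \<in> I" "i' \<in> I" "i \<noteq> i'" for i i'
  proof -
    obtain j k j' k' where ii: "i = (j, k)" "i' = (j', k')" by fastforce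
    show ?thesis
    proof (cases "k = k'")
      case True
      have "dist (fst (c i)) (fst (c i')) = norm ((real j' / N - real j / N) *\<^sub>R sgn a)"
        using True by (simp add: ii c_def dist_norm algebra_simps)
      also have "\<dots> = \<bar>real j' / N - real j / N\<bar>" using e by simp
      finally show ?thesis
        using gap[of j' j] True that(3) dist_fst_le[of "c i" "c i'"] r by (simp add: ii)
    next
      case False
      then show ?thesis
        using gap[OF False] dist_snd_le[of "c i" "c i'"] r by (simp add: ii c_def dist_real_def)
    qed
  qed
  show "ball (c i) r \<subseteq> cball 0 (4 + norm a)" if "i \<in> I" for i
  proof
    fix y assume y: "y \<in> ball (c i) r"
    obtain j k where i: "i = (j, k)" by fastforce
    have jk: "real j / N \<le> 1" "real k / N \<le> 1" "0 \<le> real k / N" "0 \<le> real j / N"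
      using that by (auto simp: i I_def divide_simps)
    have "norm (c i) \<le> norm (fst (c i)) + norm (snd (c i))"
      using norm_Pair_le[of "fst (c i)" "snd (c i)"] by simp
    also have "\<dots> \<le> (norm ((real k / N) *\<^sub>R a) + norm ((1 + real j / N) *\<^sub>R sgn a)) + 1"
      using norm_triangle_ineq4[of "(real k / N) *\<^sub>R a" "(1 + real j / N) *\<^sub>R sgn a"] jk
      by (simp add: i c_def)
    also have "\<dots> \<le> (norm a + 2) + 1"
    proof -
      have "real k / N * norm a \<le> norm a" using jk by (intro mult_left_le_one_le) auto
      then show ?thesis using jk e by simp
    qed
    finally have "norm (c i) \<le> norm a + 3" by simp
    then show "y \<in> cball 0 (4 + norm a)"
      using y r norm_triangle_ineq2[of y "c i"] by (simp add: dist_norm norm_minus_commute)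
  qed
  show "norm a * norm (x - t *\<^sub>R a) + a \<bullet> (x - t *\<^sub>R a) \<le> 2 * norm a * (r * (1 + norm a))\<^sup>2"
    if "i \<in> I" and xt: "(x, t) \<in> ball (c i) r" for i x t
  proof -
    obtain j k where i: "i = (j, k)" by fastforce
    define h where "h = (x - fst (c i)) - (t - snd (c i)) *\<^sub>R a"
    have z: "x - t *\<^sub>R a = h - (1 + real j / N) *\<^sub>R sgn a"
      by (simp add: h_def i c_def algebra_simps)
    have "norm (x - fst (c i)) \<le> r" "\<bar>t - snd (c i)\<bar> \<le> r"
      using xt dist_fst_le[of "c i" "(x, t)"] dist_snd_le[of "c i" "(x, t)"]
      by (auto simp: dist_norm norm_minus_commute dist_real_def abs_minus_commute)
    then have "norm (x - fst (c i)) + norm ((t - snd (c i)) *\<^sub>R a) \<le> r + r * norm a"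
      by (intro add_mono) (auto intro: mult_right_mono)
    then have "norm h \<le> r + r * norm a"
      unfolding h_def by (rule order_trans[OF norm_triangle_ineq4])
    moreover have "r * (1 + norm a) \<le> 1/2"
      using N N1 by (simp add: r_def divide_simps)
    ultimately show ?thesis
      unfolding z by (intro norm_add_inner_near_ray) (auto simp: algebra_simps)
  qed
qed

section \<open>Failure of local integrability\<close>

theorem mainTheorem3:
  fixes a :: "real ^ 'n" and m C :: real
  assumes "CARD('n) \<ge> 2"
    and "m_star CARD('n) < m" and "m < 1"
    and "a \<noteq> 0"
    and "C > 0"
    and "\<forall>z \<in> tw_domain a. solves_fde_at m (tw_sol C m a) z"
  shows "\<forall>p \<ge> 1. tw_sol C m a \<notin> Lp_loc p"
proof (intro allI impI notI)
  fix p :: real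
  assume p: "p \<ge> 1" and L: "tw_sol C m a \<in> Lp_loc p"
  define n where "n = CARD('n)"
  define q where "q = p / (1 - m)"
  define K where "K = (cball 0 (4 + norm a) :: ((real ^ 'n) \<times> real) set)"
  define J where "J = (LINT z:K|lebesgue. \<bar>tw_sol C m a z\<bar> powr p)"
  \<comment> \<open>For the radius \<open>1/(2N)\<close> the profile is at most \<open>A/N\<^sup>2\<close> on the balls.\<close>
  define A where "A = 2 * norm a * ((1 + norm a) / 2)\<^sup>2"
  define b where "b = C powr p * A powr (- q) * unit_ball_vol (real (n + 1)) * (1/2) ^ (n + 1)"
  have int: "set_integrable lebesgue K (\<lambda>z. \<bar>tw_sol C m a z\<bar> powr p)"
    using L by (simp add: Lp_loc_def K_def)
  have "A > 0" using assms(4) unfolding A_def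
    by (intro mult_pos_pos zero_less_power) (auto simp: add_pos_nonneg)
  then have b: "b > 0" using assms(5) by (simp add: b_def)
  have gt: "real n - 1 < 2 * q"
    unfolding q_def n_def using assms(1-3) p by (intro critical_exponent) auto
  \<comment> \<open>The exponent collects \<open>2q\<close> from the size of the function, \<open>2\<close> from the number of balls
    and \<open>-(n+1)\<close> from the volume of one ball.\<close>
  have bound: "b * real N powr (2 * q - (real n - 1)) \<le> J" if N: "1 + norm a \<le> real N" for N :: nat
  proof -
    have N0: "real N > 0" using N norm_ge_zero[of a] by linarith
    define r where "r = 1 / (2 * real N)"
    define M where "M = C powr p * (2 * norm a * (r * (1 + norm a))\<^sup>2) powr (- q)"
    note balls = packed_balls_near_singular_set[OF assms(4) N, folded r_def]
    have "M * (real (card ({..<N} \<times> {..<N})) * (unit_ball_vol (real DIM((real ^ 'n) \<times> real))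
             * r ^ DIM((real ^ 'n) \<times> real))) \<le> J"
      unfolding J_def
    proof (rule integral_ge_of_separated_balls[OF _ _ balls(1) _ int _
            negligible_Compl_tw_domain[OF assms(1,4)]])
      fix i y assume "i \<in> {..<N} \<times> {..<N}"
        and y: "y \<in> ball (case i of (j, k) \<Rightarrow>
              ((real k / N) *\<^sub>R a - (1 + real j / N) *\<^sub>R sgn a, real k / N)) r"
          "y \<notin> - tw_domain a"
      then show "M \<le> \<bar>tw_sol C m a y\<bar> powr p"
        using balls(3) assms(3,5) p unfolding M_def q_def
        by (cases y) (auto intro!: tw_sol_powr_ge)
    qed (use balls(2) in \<open>auto simp: r_def K_def\<close>)
    moreover have "2 * norm a * (r * (1 + norm a))\<^sup>2 = A * real N powr (- 2)"
      using N0 by (simp add: A_def r_def power2_eq_square powr_minus powr_realpow[symmetric] divide_simps)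
    moreover have "(A * real N powr (- 2)) powr (- q) = A powr (- q) * real N powr (2 * q)"
      using \<open>A > 0\<close> by (simp add: powr_mult powr_powr)
    moreover have "r ^ (n + 1) = (1/2) ^ (n + 1) * real N powr (- (real n + 1))"
    proof -
      have "real N powr (- (real n + 1)) = inverse (real N ^ (n + 1))"
        using N0 powr_realpow[of "real N" "n + 1"] powr_minus[of "real N" "real n + 1"]
        by (simp add: add.commute)
      then show ?thesis by (simp add: r_def power_divide power_mult_distrib divide_simps)
    qed
    moreover have "real (card ({..<N} \<times> {..<N})) = real N powr 2"
      using N0 by (simp add: card_cartesian_product power2_eq_square)
    moreover have "DIM((real ^ 'n) \<times> real) = n + 1" by (simp add: n_def)
    ultimately have "C powr p * (A powr (- q) * real N powr (2 * q)) *
        (real N powr 2 * (unit_ball_vol (real (n + 1)) *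
          ((1/2) ^ (n + 1) * real N powr (- (real n + 1))))) \<le> J"
      unfolding M_def by (simp only:)
    then have "b * (real N powr (2 * q) * real N powr 2 * real N powr (- (real n + 1))) \<le> J"
      unfolding b_def by (simp only: mult_ac)
    moreover have "real N powr (2 * q) * real N powr 2 * real N powr (- (real n + 1))
        = real N powr (2 * q - (real n - 1))"
      unfolding powr_add[symmetric] by (rule arg_cong[where f = "(powr) (real N)"]) simp
    ultimately show ?thesis by (simp only:)
  qed
  have "filterlim (\<lambda>N. b * real N powr (2 * q - (real n - 1))) at_top sequentially"
    using b gt by real_asymp
  then have "eventually (\<lambda>N. J < b * real N powr (2 * q - (real n - 1))) sequentially"
    by (simp add: filterlim_at_top_dense)
  moreover have "eventually (\<lambda>N. 1 + norm a \<le> real N) sequentially"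
    using filterlim_real_sequentially unfolding filterlim_at_top by blast
  ultimately have "eventually (\<lambda>N::nat. False) sequentially"
    by eventually_elim (use bound in force)
  then show False by simp
qed

end
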